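(* For integers $s,t\ge 2$, $$r\!\left(K_{n,n},K_{s,st},\,s^2t-t(s-1)+1\right)=\Omega\!\left(n^{1+1/t}\right).$$
   Context: For graphs $G,H$ and an integer $q$ with $2\le q\le |E(H)|$, an $(H,q)$-coloring of $G$ is an edge-coloring of $G$ in which every subgraph of $G$ isomorphic to $H$ receives at least $q$ distinct colors; $r(G,H,q)$ is the minimum number of colors needed for $G$ to have an $(H,q)$-coloring. $K_{a,b}$ denotes the complete bipartite graph with parts of sizes $a$ and $b$. Asymptotic notation refers to $n\to\infty$ with $s,t$ fixed. *)

theory Defs
  imports Complex_Main "HOL-Library.Landau_Symbols"
begin

record 'a graph =
  verts :: "'a set"
  edges :: "'a set set"

definition simple_graph :: "'a graph \<Rightarrow> bool" where
  "simple_graph G \<longleftrightarrow> finite (verts G) \<and> (\<forall>e \<in> edges G. e \<subseteq> verts G \<and> card e = 2)"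

text \<open>Subgraphs are not required to be induced.\<close>

definition subgraph :: "'a graph \<Rightarrow> 'a graph \<Rightarrow> bool" where
  "subgraph F G \<longleftrightarrow> simple_graph F \<and> verts F \<subseteq> verts G \<and> edges F \<subseteq> edges G"

definition isomorphic :: "'a graph \<Rightarrow> 'b graph \<Rightarrow> bool" where
  "isomorphic F H \<longleftrightarrow>
     (\<exists>f. bij_betw f (verts F) (verts H) \<and>
          (\<forall>u \<in> verts F. \<forall>v \<in> verts F. {u, v} \<in> edges F \<longleftrightarrow> {f u, f v} \<in> edges H))"

text \<open>Colors are natural numbers, which is no restriction for finite graphs. Only the values of
  a coloring on \<open>edges G\<close> matter, and the coloring need not be proper.\<close>

definition Hq_coloring :: "'a graph \<Rightarrow> 'b graph \<Rightarrow> nat \<Rightarrow> ('a set \<Rightarrow> nat) \<Rightarrow> bool" where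
  "Hq_coloring G H q c \<longleftrightarrow>
     (\<forall>F. subgraph F G \<and> isomorphic F H \<longrightarrow> q \<le> card (c ` edges F))"

definition gen_ramsey :: "'a graph \<Rightarrow> 'b graph \<Rightarrow> nat \<Rightarrow> nat" where
  "gen_ramsey G H q = (LEAST k. \<exists>c. Hq_coloring G H q c \<and> card (c ` edges G) = k)"

definition complete_bipartite :: "nat \<Rightarrow> nat \<Rightarrow> (nat + nat) graph" where
  "complete_bipartite a b =
     \<lparr>verts = Inl ` {..<a} \<union> Inr ` {..<b},
      edges = {{Inl i, Inr j} | i j. i < a \<and> j < b}\<rparr>"

lemma simple_graph_complete_bipartite: "simple_graph (complete_bipartite a b)"
  by (auto simp: simple_graph_def complete_bipartite_def)

lemma card_edges_complete_bipartite: "card (edges (complete_bipartite a b)) = a * b"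
proof -
  have "edges (complete_bipartite a b) = (\<lambda>(i, j). {Inl i, Inr j}) ` ({..<a} \<times> {..<b})"
    by (auto simp: complete_bipartite_def)
  moreover have "inj_on (\<lambda>(i, j). {Inl i, Inr j :: nat + nat}) ({..<a} \<times> {..<b})"
    by (auto simp: inj_on_def doubleton_eq_iff)
  ultimately show ?thesis
    by (simp add: card_image)
qed

lemma card_edges_isomorphic:
  assumes F: "simple_graph F" and H: "simple_graph H" and iso: "isomorphic F H"
  shows "card (edges F) = card (edges H)"
proof -
  obtain f where bij: "bij_betw f (verts F) (verts H)"
    and adj: "\<And>u v. u \<in> verts F \<Longrightarrow> v \<in> verts F \<Longrightarrow> {u, v} \<in> edges F \<longleftrightarrow> {f u, f v} \<in> edges H"
    using iso by (auto simp: isomorphic_def)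
  have inj: "inj_on ((`) f) (edges F)"
    using F bij by (intro inj_on_subset[OF inj_on_image_Pow[of f "verts F"]])
      (auto simp: simple_graph_def bij_betw_def)
  have "(`) f ` edges F = edges H"
  proof (intro equalityI subsetI)
    fix e assume "e \<in> (`) f ` edges F"
    then obtain d where d: "d \<in> edges F" "e = f ` d" by auto
    then obtain u v where "d = {u, v}" "u \<in> verts F" "v \<in> verts F"
      using F by (fastforce simp: simple_graph_def card_2_iff)
    then show "e \<in> edges H" using adj d by auto
  next
    fix e assume e: "e \<in> edges H"
    then obtain x y where xy: "e = {x, y}" "x \<in> verts H" "y \<in> verts H"
      using H by (fastforce simp: simple_graph_def card_2_iff)
    then obtain u v where uv: "u \<in> verts F" "v \<in> verts F" "x = f u" "y = f v"
      using bij unfolding bij_betw_def by blast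
    then have "{u, v} \<in> edges F" using adj e xy by auto
    then have "f ` {u, v} \<in> (`) f ` edges F" by (rule imageI)
    then show "e \<in> (`) f ` edges F" using uv xy by simp
  qed
  with inj show ?thesis by (metis card_image)
qed

text \<open>For \<open>q \<le> card (edges H)\<close> the minimum in \<open>gen_ramsey\<close> ranges over a nonempty set.\<close>

lemma Hq_coloring_exists:
  fixes G :: "'a graph" and H :: "'b graph"
  assumes G: "simple_graph G" and H: "simple_graph H" and q: "q \<le> card (edges H)"
  shows "\<exists>c. Hq_coloring G H q c"
proof -
  have "edges G \<subseteq> Pow (verts G)" "finite (verts G)"
    using G by (auto simp: simple_graph_def)
  then have "finite (edges G)"
    by (meson finite_Pow_iff finite_subset)
  then obtain c :: "'a set \<Rightarrow> nat" where c: "inj_on c (edges G)"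
    using finite_imp_inj_to_nat_seg by blast
  have "Hq_coloring G H q c"
    unfolding Hq_coloring_def
  proof (intro allI impI)
    fix F assume F: "subgraph F G \<and> isomorphic F H"
    then have "card (edges F) = card (edges H)"
      using H by (auto simp: subgraph_def intro: card_edges_isomorphic)
    moreover have "inj_on c (edges F)"
      using F c by (auto simp: subgraph_def intro: inj_on_subset)
    ultimately show "q \<le> card (c ` edges F)"
      using q by (simp add: card_image)
  qed
  then show ?thesis by blast
qed

end

theory Submission
  imports Defs
begin

text \<open>
  A copy of \<open>K\<^bsub>s,st\<^esub>\<close> with a set of \<open>st\<close> edges that carries at most \<open>t\<close> colors has at most
  \<open>s\<^sup>2t - st + t\<close> colors, one too few. Such a set is found in two situations. If a left vertex \<open>x\<close>
  sees fewer than about \<open>n/s\<close> colors, then \<open>t\<close> disjoint monochromatic stars with \<open>s\<close> edges can be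
  chosen at \<open>x\<close>. If \<open>s\<close> left vertices see \<open>t\<close> common colors, one edge per vertex and color will do.
  Hence every left vertex sees at least \<open>n/(2s)\<close> colors, and the bipartite incidence graph between
  left vertices and colors has no \<open>K\<^bsub>s,t\<^esub>\<close>; the Kovari--Sos--Turan double count then bounds the
  number of colors from below.
\<close>

section \<open>Maps taking few values on a large set\<close>

lemma exists_large_fiber:
  assumes "finite A" "m * card (g ` A) < card A"
  shows "\<exists>y. m < card {a \<in> A. g a = y}"
proof (rule ccontr)
  assume "\<nexists>y. m < card {a \<in> A. g a = y}"
  then have le: "card {a \<in> A. g a = y} \<le> m" for y by (meson not_le)
  have "card A = (\<Sum>y\<in>g ` A. card {a \<in> A. g a = y})"
    using sum.image_gen[OF assms(1), of "\<lambda>_. 1::nat" g] by simp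
  also have "\<dots> \<le> (\<Sum>y\<in>g ` A. m)" by (intro sum_mono le)
  finally show False using assms(2) by (simp add: mult.commute)
qed

text \<open>Greedy choice: take \<open>s\<close> elements of one fiber, remove them and repeat
  \<open>t\<close> times. Each round lowers both sides of the hypothesis enough to keep it, since
  removal cannot create new values.\<close>

lemma subset_with_few_values:
  assumes "finite A" "s * card (g ` A) + s * t \<le> card A"
  shows "\<exists>B\<subseteq>A. card B = s * t \<and> card (g ` B) \<le> t"
  using assms
proof (induction t arbitrary: A)
  case 0
  then show ?case by (intro exI[of _ "{}"]) auto
next
  case (Suc t)
  show ?case
  proof (cases "s = 0")
    case True
    then show ?thesis by (intro exI[of _ "{}"]) auto
  next
    case False
    \<comment> \<open>Pigeonhole with \<open>s - 1\<close> yields a fiber with at least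
      \<open>s\<close> elements.\<close>
    then have "(s - 1) * card (g ` A) < card A"
      using Suc.prems(2) by (auto simp: diff_mult_distrib)
    then obtain y where "s - 1 < card {a \<in> A. g a = y}"
      using exists_large_fiber[OF Suc.prems(1)] by blast
    then obtain C where C: "C \<subseteq> {a \<in> A. g a = y}" "card C = s"
      using obtain_subset_with_card_n[of s "{a \<in> A. g a = y}"] False
      by (metis Suc_leI Suc_diff_1 not_gr_zero)
    have fin: "finite C" using C(1) Suc.prems(1) finite_subset by fastforce
    have card_diff: "card (A - C) = card A - s"
      using C fin by (subst card_Diff_subset) auto
    have "card (g ` (A - C)) \<le> card (g ` A)"
      using Suc.prems(1) by (intro card_mono) auto
    then have "s * card (g ` (A - C)) \<le> s * card (g ` A)" by simp
    then have "s * card (g ` (A - C)) + s * t \<le> card (A - C)"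
      using Suc.prems(2) card_diff unfolding mult_Suc_right by linarith
    then obtain B where B: "B \<subseteq> A - C" "card B = s * t" "card (g ` B) \<le> t"
      using Suc.IH[of "A - C"] Suc.prems(1) by auto
    have finB: "finite B" using B(1) Suc.prems(1) finite_subset by blast
    have "card (B \<union> C) = s * Suc t"
      using B C fin finB by (subst card_Un_disjoint) auto
    moreover have "g ` (B \<union> C) \<subseteq> insert y (g ` B)" using C by auto
    then have "card (g ` (B \<union> C)) \<le> card (insert y (g ` B))"
      using finB by (intro card_mono) auto
    then have "card (g ` (B \<union> C)) \<le> Suc t"
      using B(3) finB by (simp add: card_insert_if split: if_splits)
    ultimately show ?thesis using B C by (intro exI[of _ "B \<union> C"]) auto
  qed
qed

lemma card_image_le_saved:
  assumes "finite A" "B \<subseteq> A"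
  shows "card (g ` A) \<le> card (g ` B) + (card A - card B)"
proof -
  have fin: "finite B" using assms finite_subset by blast
  have "g ` A = g ` B \<union> g ` (A - B)" using assms by auto
  then have "card (g ` A) \<le> card (g ` B) + card (g ` (A - B))"
    by (metis card_Un_le)
  also have "card (g ` (A - B)) \<le> card (A - B)"
    using assms by (intro card_image_le) auto
  also have "card (A - B) = card A - card B"
    using assms fin by (simp add: card_Diff_subset)
  finally show ?thesis by simp
qed

section \<open>Colorings of an \<open>n\<close> by \<open>n\<close> grid\<close>

text \<open>\<open>col x y\<close> is the color of the edge between left vertex \<open>x\<close> and
  right vertex \<open>y\<close>. In \<open>many_colors\<close> the subtractions are moved across the
  inequality to avoid truncation on naturals.\<close>

locale rectangle_coloring =
  fixes n s t :: nat and col :: "nat \<Rightarrow> nat \<Rightarrow> nat"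
  assumes s_pos: "s \<ge> 1" and t_pos: "t \<ge> 1" and large: "n \<ge> 2 * s * t"
    and many_colors: "\<lbrakk>S \<subseteq> {..<n}; card S = s; T \<subseteq> {..<n}; card T = s * t\<rbrakk>
      \<Longrightarrow> s * (s * t) + t < card (case_prod col ` (S \<times> T)) + s * t"
begin

definition seen :: "nat \<Rightarrow> nat set" where
  "seen x = col x ` {..<n}"

definition palette :: "nat set" where
  "palette = (\<Union>x<n. seen x)"

lemma finite_seen: "finite (seen x)"
  by (simp add: seen_def)

lemma finite_palette: "finite palette"
  by (simp add: palette_def finite_seen)

lemma s_le: "s \<le> n" and st_le: "s * t \<le> n"
proof -
  show "s * t \<le> n" using large by simp
  then show "s \<le> n" using t_pos by (metis le_trans mult_le_mono2 mult.right_neutral)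
qed

text \<open>After enlarging \<open>S\<close> and \<open>T\<close> to full size, at most
  \<open>t\<close> colors on \<open>E\<close> would leave at most
  \<open>s * (s * t) - s * t + t\<close> colors on the rectangle, against
  \<open>many_colors\<close>.\<close>

lemma no_saving:
  assumes S: "S \<subseteq> {..<n}" "card S \<le> s" and T: "T \<subseteq> {..<n}" "card T \<le> s * t"
    and E: "E \<subseteq> S \<times> T" "card E = s * t"
  shows "t < card (case_prod col ` E)"
proof -
  obtain S' where S': "S \<subseteq> S'" "S' \<subseteq> {..<n}" "card S' = s"
    using exists_subset_between[OF S(2) _ S(1)] s_le by auto
  obtain T' where T': "T \<subseteq> T'" "T' \<subseteq> {..<n}" "card T' = s * t"
    using exists_subset_between[OF T(2) _ T(1)] st_le by auto
  have fin: "finite (S' \<times> T')" using S' T' by (meson finite_SigmaI finite_lessThan finite_subset)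
  have sub: "E \<subseteq> S' \<times> T'" using E S' T' by auto
  have "card (S' \<times> T') = s * (s * t)" using S' T' by (simp add: card_cartesian_product)
  moreover have "s * t \<le> s * (s * t)" using s_pos by simp
  ultimately show ?thesis
    using card_image_le_saved[OF fin sub, of "case_prod col"] E(2)
      many_colors[OF S'(2,3) T'(2,3)] by linarith
qed

text \<open>The factor 2 splits \<open>n\<close> into halves: one bounds
  \<open>s * card (seen x)\<close>, the other contains \<open>s * t\<close> by \<open>large\<close>.
  Otherwise \<open>s * t\<close> edges at \<open>x\<close> would share at most \<open>t\<close>
  colors.\<close>

lemma card_seen_gt:
  assumes "x < n"
  shows "n < 2 * s * card (seen x)"
proof (rule ccontr)
  assume "\<not> ?thesis"
  then have "s * card (col x ` {..<n}) + s * t \<le> card {..<n}"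
    using large by (simp add: seen_def)
  then obtain B where B: "B \<subseteq> {..<n}" "card B = s * t" "card (col x ` B) \<le> t"
    using subset_with_few_values[OF finite_lessThan] by blast
  have "t < card (case_prod col ` ({x} \<times> B))"
    using assms B s_pos by (intro no_saving[of "{x}" B]) (auto simp: card_cartesian_product)
  also have "case_prod col ` ({x} \<times> B) = col x ` B" by auto
  finally show False using B(3) by simp
qed

lemma card_common_lt:
  assumes P: "card P = t"
  shows "card {x. x < n \<and> P \<subseteq> seen x} < s"
proof (rule ccontr)
  assume "\<not> ?thesis"
  then obtain S where S: "S \<subseteq> {x. x < n \<and> P \<subseteq> seen x}" "card S = s"
    using obtain_subset_with_card_n by (meson not_le)
  have finP: "finite P" using P t_pos by (auto intro: card_ge_0_finite)
  have finS: "finite S" using S s_pos by (auto intro: card_ge_0_finite)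
  have "\<exists>y<n. col x y = p" if "x \<in> S" "p \<in> P" for x p
    using S(1) that by (force simp: seen_def)
  then obtain y where y: "\<And>x p. \<lbrakk>x \<in> S; p \<in> P\<rbrakk> \<Longrightarrow> y x p < n \<and> col x (y x p) = p"
    by metis
  define E where "E = (\<lambda>(x, p). (x, y x p)) ` (S \<times> P)"
  define T where "T = case_prod y ` (S \<times> P)"
  have card_prod: "card (S \<times> P) = s * t" by (simp add: card_cartesian_product S P)
  \<comment> \<open>The color of the chosen edge recovers \<open>p\<close>.\<close>
  have "inj_on (\<lambda>(x, p). (x, y x p)) (S \<times> P)"
    by (rule inj_onI) (use y in \<open>auto, metis\<close>)
  then have "card E = s * t" unfolding E_def by (simp add: card_image card_prod)
  \<comment> \<open>Columns chosen for different rows may coincide, so only an upper bound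
    holds.\<close>
  moreover have "card T \<le> s * t"
    unfolding T_def using card_image_le[of "S \<times> P" "case_prod y"] finS finP card_prod by simp
  moreover have "S \<subseteq> {..<n}" "T \<subseteq> {..<n}" "E \<subseteq> S \<times> T"
    using S y by (auto simp: T_def E_def)
  ultimately have "t < card (case_prod col ` E)"
    using S(2) by (intro no_saving) auto
  moreover have "case_prod col ` E \<subseteq> P" using y by (auto simp: E_def)
  then have "card (case_prod col ` E) \<le> t" using P finP card_mono by blast
  ultimately show False by simp
qed

text \<open>Double count the pairs of a row \<open>x\<close> and a \<open>t\<close>-set
  \<open>P\<close> of colors seen at \<open>x\<close>; each \<open>P\<close> occurs in fewer than
  \<open>s\<close> rows.\<close>

lemma sum_choose_seen_le:
  "(\<Sum>x<n. card (seen x) choose t) \<le> s * (card palette choose t)"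
proof -
  define Q where "Q = {P. P \<subseteq> palette \<and> card P = t}"
  have finQ: "finite Q" unfolding Q_def using finite_palette by simp
  have "(\<Sum>x<n. card (seen x) choose t) = (\<Sum>x<n. card {P \<in> Q. P \<subseteq> seen x})"
  proof (rule sum.cong)
    fix x assume "x \<in> {..<n}"
    then have "seen x \<subseteq> palette" by (auto simp: palette_def)
    then have "{P \<in> Q. P \<subseteq> seen x} = {P. P \<subseteq> seen x \<and> card P = t}" by (auto simp: Q_def)
    then show "card (seen x) choose t = card {P \<in> Q. P \<subseteq> seen x}"
      by (simp add: n_subsets finite_seen)
  qed simp
  also have "\<dots> = (\<Sum>P\<in>Q. card {x \<in> {..<n}. P \<subseteq> seen x})"
    using sum_multicount_gen[of "{..<n}" Q "\<lambda>x P. P \<subseteq> seen x"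
        "\<lambda>P. card {x \<in> {..<n}. P \<subseteq> seen x}"] finQ by simp
  also have "\<dots> \<le> (\<Sum>P\<in>Q. s)"
    using card_common_lt by (intro sum_mono) (auto simp: Q_def intro: less_imp_le)
  also have "\<dots> = s * (card palette choose t)"
    using finite_palette by (simp add: Q_def n_subsets)
  finally show ?thesis .
qed

lemma palette_lower_bound:
  "real n powr (1 + 1 / real t) \<le> 2 * real s ^ 2 * real t * real (card palette)"
proof -
  let ?k = "card palette"
  have n_pos: "n > 0" using large s_pos t_pos by (auto intro: gr0I)
  have choose_ge: "(real n / (2 * s * t)) ^ t \<le> real (card (seen x) choose t)"
    if "x < n" for x
  proof -
    let ?d = "card (seen x)"
    have d: "n < 2 * s * ?d" by (rule card_seen_gt[OF that])
    then have "2 * s * t < 2 * s * ?d" using large by linarith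
    \<comment> \<open>The bound \<open>(d / t) ^ t \<le> d choose t\<close> requires this.\<close>
    then have td: "t \<le> ?d" by simp
    have "real n \<le> real (2 * s * ?d)" using d by linarith
    then have "real n / (2 * s * t) \<le> real ?d / real t"
      using s_pos t_pos by (simp add: field_simps)
    then have "(real n / (2 * s * t)) ^ t \<le> (real ?d / real t) ^ t"
      by (intro power_mono) auto
    also have "\<dots> \<le> real (?d choose t)"
      using binomial_ge_n_over_k_pow_k[OF td, where 'a = real] by simp
    finally show ?thesis .
  qed
  have "real n * (real n / (2 * s * t)) ^ t = (\<Sum>x<n. (real n / (2 * s * t)) ^ t)"
    by simp
  also have "\<dots> \<le> (\<Sum>x<n. real (card (seen x) choose t))"
    using choose_ge by (intro sum_mono) auto
  also have "\<dots> \<le> real (s * (?k choose t))"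
    using sum_choose_seen_le by (metis of_nat_le_iff of_nat_sum)
  also have "\<dots> \<le> real (s * ?k ^ t)"
    by (cases "t \<le> ?k") (auto intro!: mult_left_mono binomial_le_pow simp: binomial_eq_0 simp flip: of_nat_power)
  also have "\<dots> = real s * real ?k ^ t" by simp
  \<comment> \<open>Weakening \<open>s\<close> to \<open>s ^ t\<close> makes the right side a
    \<open>t\<close>-th power; this gives the second factor \<open>s\<close> in the constant, the
    first coming from \<open>2 * s * t\<close>.\<close>
  also have "\<dots> \<le> real s ^ t * real ?k ^ t"
    using s_pos t_pos by (intro mult_right_mono self_le_power) auto
  finally have "real n * real n ^ t \<le> (real s * real ?k) ^ t * (2 * s * t) ^ t"
    using s_pos t_pos by (simp add: power_divide power_mult_distrib field_simps)
  also have "\<dots> = (2 * real s ^ 2 * real t * real ?k) ^ t"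
    by (simp add: power_mult_distrib power2_eq_square flip: power_mult)
  finally have pow: "real n * real n ^ t \<le> (2 * real s ^ 2 * real t * real ?k) ^ t" .
  have "(real n powr (1 + 1 / real t)) ^ t = real n powr ((1 + 1 / real t) * t)"
    using n_pos by (simp add: powr_powr flip: powr_realpow)
  also have "(1 + 1 / real t) * t = 1 + real t"
    using t_pos by (simp add: field_simps)
  also have "real n powr (1 + real t) = real n * real n ^ t"
    using n_pos by (simp add: powr_add powr_realpow)
  finally have "(real n powr (1 + 1 / real t)) ^ t \<le> (2 * real s ^ 2 * real t * real ?k) ^ t"
    using pow by simp
  then show ?thesis
    using t_pos by (subst (asm) power_mono_iff) auto
qed

end

section \<open>From graph colorings to grids\<close>

lemma isomorphic_complete_bipartite:
  assumes "finite S" "finite T"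
  shows "isomorphic \<lparr>verts = Inl ` S \<union> Inr ` T, edges = {{Inl i, Inr j} | i j. i \<in> S \<and> j \<in> T}\<rparr>
    (complete_bipartite (card S) (card T))"
proof -
  obtain f where f: "bij_betw f S {..<card S}"
    using ex_bij_betw_finite_nat[OF assms(1)] by (auto simp: atLeast0LessThan)
  obtain g where g: "bij_betw g T {..<card T}"
    using ex_bij_betw_finite_nat[OF assms(2)] by (auto simp: atLeast0LessThan)
  have "inj_on (map_sum f g) (Inl ` S \<union> Inr ` T)"
    using bij_betw_imp_inj_on[OF f] bij_betw_imp_inj_on[OF g]
    by (intro inj_onI) (auto dest: inj_onD)
  moreover have "map_sum f g ` (Inl ` S \<union> Inr ` T) = Inl ` {..<card S} \<union> Inr ` {..<card T}"
    using bij_betw_imp_surj_on[OF f] bij_betw_imp_surj_on[OF g]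
    by (simp add: image_Un image_image) (metis image_image)
  ultimately have "bij_betw (map_sum f g) (Inl ` S \<union> Inr ` T) (Inl ` {..<card S} \<union> Inr ` {..<card T})"
    by (simp add: bij_betw_def)
  moreover have "f i < card S" if "i \<in> S" for i
    using bij_betwE[OF f] that by auto
  moreover have "g j < card T" if "j \<in> T" for j
    using bij_betwE[OF g] that by auto
  ultimately show ?thesis
    unfolding isomorphic_def complete_bipartite_def
    by (intro exI[of _ "map_sum f g"]) (auto simp: doubleton_eq_iff)
qed

lemma Hq_coloring_rectangle:
  assumes c: "Hq_coloring (complete_bipartite m n) (complete_bipartite a b) q c"
    and S: "S \<subseteq> {..<m}" "card S = a" and T: "T \<subseteq> {..<n}" "card T = b"
  shows "q \<le> card ((\<lambda>(i, j). c {Inl i, Inr j}) ` (S \<times> T))"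
proof -
  let ?E = "{{Inl i, Inr j} | i j. i \<in> S \<and> j \<in> T}"
  let ?F = "\<lparr>verts = Inl ` S \<union> Inr ` T, edges = ?E\<rparr>"
  have fin: "finite S" "finite T" using S(1) T(1) finite_subset by blast+
  have "subgraph ?F (complete_bipartite m n)"
    using S(1) T(1) fin by (auto simp: subgraph_def simple_graph_def complete_bipartite_def)
  moreover have "isomorphic ?F (complete_bipartite a b)"
    using isomorphic_complete_bipartite[OF fin] S T by simp
  ultimately have "q \<le> card (c ` edges ?F)"
    using c unfolding Hq_coloring_def by blast
  also have "c ` edges ?F = (\<lambda>(i, j). c {Inl i, Inr j}) ` (S \<times> T)" by auto
  finally show ?thesis .
qed

text \<open>\<open>LEAST\<close> attains its value because some valid coloring exists.\<close>

lemma gen_ramsey_attained: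
  assumes "simple_graph G" "simple_graph H" "q \<le> card (edges H)"
  obtains c where "Hq_coloring G H q c" "card (c ` edges G) = gen_ramsey G H q"
proof -
  have "\<exists>k c. Hq_coloring G H q c \<and> card (c ` edges G) = k"
    using Hq_coloring_exists[OF assms] by blast
  from LeastI_ex[OF this] show ?thesis
    using that unfolding gen_ramsey_def by blast
qed

lemma gen_ramsey_lower_bound:
  assumes s: "s \<ge> 2" and t: "t \<ge> 1" and n: "n \<ge> 2 * s * t"
  shows "real n powr (1 + 1 / real t) \<le> 2 * real s ^ 2 * real t *
    real (gen_ramsey (complete_bipartite n n) (complete_bipartite s (s * t))
      (s\<^sup>2 * t - t * (s - 1) + 1))"
proof -
  let ?G = "complete_bipartite n n" and ?H = "complete_bipartite s (s * t)"
  let ?q = "s\<^sup>2 * t - t * (s - 1) + 1"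
  \<comment> \<open>Writing \<open>s - 1\<close> as \<open>r\<close> removes the inner subtraction,
    so that \<open>?q\<close> can be brought to the form of \<open>many_colors\<close>.\<close>
  obtain r where r: "s = Suc r" "r \<ge> 1" using s by (cases s) auto
  have q: "?q + s * t = s * (s * t) + t + 1"
    using r by (simp add: power2_eq_square algebra_simps)
  \<comment> \<open>This is where \<open>s \<ge> 2\<close> enters: \<open>?q\<close> does not exceed
    the number of edges of \<open>?H\<close>.\<close>
  have "t + 1 \<le> s * t" using r t by (cases r; cases t) auto
  then have "?q \<le> card (edges ?H)" using q by (simp add: card_edges_complete_bipartite)
  then obtain c where c: "Hq_coloring ?G ?H ?q c"
      and card_c: "card (c ` edges ?G) = gen_ramsey ?G ?H ?q"
    using gen_ramsey_attained simple_graph_complete_bipartite by metis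
  define col where "col i j = c {Inl i, Inr j}" for i j
  interpret rectangle_coloring n s t col
  proof
    fix S T assume "S \<subseteq> {..<n}" "card S = s" "T \<subseteq> {..<n}" "card T = s * t"
    from Hq_coloring_rectangle[OF c this]
    show "s * (s * t) + t < card (case_prod col ` (S \<times> T)) + s * t"
      using q by (simp add: case_prod_unfold col_def)
  qed (use s t n in auto)
  have "palette = c ` edges ?G"
    by (auto simp: palette_def seen_def col_def complete_bipartite_def)
  then show ?thesis using palette_lower_bound card_c by simp
qed

theorem theorem1p10:
  fixes s t :: nat
  assumes "s \<ge> 2" and "t \<ge> 2"
  shows "(\<lambda>n. real (gen_ramsey (complete_bipartite n n) (complete_bipartite s (s * t))
                      (s\<^sup>2 * t - t * (s - 1) + 1)))
           \<in> \<Omega>(\<lambda>n. real n powr (1 + 1 / real t))"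
proof -
  let ?C = "2 * real s ^ 2 * real t"
  have C: "?C > 0" using assms by simp
  show ?thesis
  proof (rule landau_omega.bigI[of "inverse ?C"])
    show "inverse ?C > 0" using C by (rule positive_imp_inverse_positive)
    show "\<forall>\<^sub>F n in sequentially. inverse ?C * norm (real n powr (1 + 1 / real t)) \<le>
      norm (real (gen_ramsey (complete_bipartite n n) (complete_bipartite s (s * t))
        (s\<^sup>2 * t - t * (s - 1) + 1)))"
      \<comment> \<open>The threshold is the size condition \<open>large\<close> of the grid
        argument.\<close>
      using eventually_ge_at_top[of "2 * s * t"]
    proof eventually_elim
      case (elim n)
      then show ?case
        using gen_ramsey_lower_bound[of s t n] assms C by (simp add: field_simps)
    qed
  qed
qed

end
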